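(* Let $\mathbf{x}\in\mathbb{R}^d$ be a sample value of $\mathbf{X}$, and assume that: (A2) the joint (resp. marginal) CDF is continuous and has a density function $\rho>0$ on its open support; (A3) each component of every dependency function $r_{\pi_{i,k}}$ ($k=2,\dots,K$, $i=1,\dots,d_k$) is differentiable with respect to $X_{\pi_{i,k}}$; (A4) the function $f:\mathbb{R}^d\to\mathbb{R}$ is differentiable with respect to each input. Then: (i) for all $k\ge2$, the dependent Jacobian matrix $\frac{\partial\mathbf{X}_{\boldsymbol{\pi}_k}}{\partial\mathbf{x}_{\boldsymbol{\pi}_k}}$ is the $d_k\times d_k$ matrix $$J^d_{\boldsymbol{\pi}_k}(\mathbf{x}_{\boldsymbol{\pi}_k})=\left[J^{(\pi_{1,k})}(\mathbf{x}_{\boldsymbol{\pi}_k})\ \cdots\ J^{(\pi_{d_k,k})}(\mathbf{x}_{\boldsymbol{\pi}_k})\right];$$ (ii) the dependent Jacobian matrix $\frac{\partial\mathbf{X}}{\partial\mathbf{x}}$ is the block-diagonal matrix $$J^d(\mathbf{x})=\begin{bmatrix}\mathcal{I}_{d_1\times d_1}&0&\cdots&0\\0&J^d_{\boldsymbol{\pi}_2}(\mathbf{x}_{\boldsymbol{\pi}_2})&\cdots&0\\\vdots&\vdots&\ddots&\vdots\\0&0&\cdots&J^d_{\boldsymbol{\pi}_K}(\mathbf{x}_{\boldsymbol{\pi}_K})\end{bmatrix};$$ (iii) the (dependent) partial derivatives of $f$ are given by $$\frac{\partial f}{\partial\mathbf{x}}(\mathbf{x})=J^d(\mathbf{x})^{T}\,\nabla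 f(\mathbf{x}).$$
   Context: $\mathbf{X}=(X_1,\dots,X_d)$ is a random vector of continuous variables with joint CDF $F$, made of independent blocks $\mathbf{X}_{\boldsymbol{\pi}_1},\dots,\mathbf{X}_{\boldsymbol{\pi}_K}$, where $\boldsymbol{\pi}_1,\dots,\boldsymbol{\pi}_K$ is a partition of $\{1,\dots,d\}$, $\mathbf{X}_{\boldsymbol{\pi}_k}=(X_i)_{i\in\boldsymbol{\pi}_k}$ and $d_k=|\boldsymbol{\pi}_k|$. The block $\mathbf{X}_{\boldsymbol{\pi}_1}$ consists of $d_1\ge 0$ independent variables; for $k\ge 2$ the block $\mathbf{X}_{\boldsymbol{\pi}_k}$ consists of $d_k\ge2$ dependent variables. Write $\boldsymbol{\pi}_k=\{\pi_{1,k}<\dots<\pi_{d_k,k}\}$ and $(\sim\pi_{i,k})=(\pi_{1,k},\dots,\pi_{i-1,k},\pi_{i+1,k},\dots,\pi_{d_k,k})$. Vectors and matrices are indexed with the coordinates ordered block by block. $\mathcal{I}$ is the identity matrix. For each $k\ge2$ and each $i=1,\dots,d_k$ one uses the dependency model of $\mathbf{X}_{\boldsymbol{\pi}_k}$ with explanatory variable $X_{\pi_{i,k}}$: $\mathbf{X}_{\sim\pi_{i,k}}=r_{\pi_{i,k}}(X_{\pi_{i,k}},\mathbf{Z}_{\pi_{i,k}})$, where $\mathbf{Z}_{\pi_{i,k}}$ is a vector of $d_k-1$ independent variables, independent of $X_{\pi_{i,k}}$. In this model the component giving $X_{\pi_{\ell,k}}$ ($\ell\ne i$) is written $r_{\pi_{\ell,k}}$.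 For given $x_{\pi_{i,k}}$ the map $\mathbf{z}\mapsto r_{\pi_{i,k}}(x_{\pi_{i,k}},\mathbf{z})$ has a unique inverse $r_{\pi_{i,k}}^{-1}(\cdot\mid x_{\pi_{i,k}})$. The partial derivatives of $\mathbf{X}_{\boldsymbol{\pi}_k}$ with respect to $X_{\pi_{i,k}}$ at $\mathbf{x}_{\boldsymbol{\pi}_k}$, computed from this model with $\mathbf{Z}_{\pi_{i,k}}$ held fixed, form the column vector $$J^{(\pi_{i,k})}(\mathbf{x}_{\boldsymbol{\pi}_k})=\frac{\partial\mathbf{X}_{\boldsymbol{\pi}_k}}{\partial x_{\pi_{i,k}}}=\left[\frac{\partial r_{\pi_{1,k}}}{\partial x_{\pi_{i,k}}}\ \cdots\ \underbrace{1}_{i\text{th}}\ \cdots\ \frac{\partial r_{\pi_{d_k,k}}}{\partial x_{\pi_{i,k}}}\right]^{T}\left(x_{\pi_{i,k}},r_{\pi_{i,k}}^{-1}(\mathbf{x}_{\sim\pi_{i,k}}\mid x_{\pi_{i,k}})\right).$$ Derivatives of a variable of one block with respect to a variable of another block are zero, and within block $1$ they are $1$ for the same variable and $0$ otherwise. The dependent Jacobian is the matrix whose $(p,q)$ entry is the derivative so defined of the $p$-th variable with respect to the $q$-th variable. $\nabla f$ is the formal (Euclidean) gradient of $f$, i.e. the vector of ordinary partial derivatives $f'_{x_p}$ obtained by holding the other inputs constant, ordered by blocks. The (dependent) partial derivative $\frac{\partial f}{\partial x_q}$ of $f$ is the chain-rule derivative accounting for the dependencies among inputs, $\frac{\partial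 f}{\partial x_q}(\mathbf{x})=\sum_{p=1}^d f'_{x_p}(\mathbf{x})\,\frac{\partial X_p}{\partial x_q}$, and $\frac{\partial f}{\partial\mathbf{x}}=\left[\frac{\partial f}{\partial x_1},\dots,\frac{\partial f}{\partial x_d}\right]^T$. *)

theory Defs
  imports
    "HOL-Probability.Probability"
    "Jordan_Normal_Form.Matrix"
begin

text \<open>
  A vector indexed by a finite set \<open>J\<close> of coordinates is an element of
  \<open>PiE J (\<lambda>_. UNIV)\<close>, so that \<open>PiE {1..d} (\<lambda>_. UNIV)\<close> plays the role of
  \<open>d\<close>-dimensional real space; the subvector of \<open>x\<close> on \<open>J\<close> is \<open>restrict x J\<close>.
  Vectors and matrices whose coordinates have been put in order are those of
  \<open>Jordan_Normal_Form\<close>, with positions counted from \<open>0\<close>.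
\<close>

definition subvector :: "nat set \<Rightarrow> (nat \<Rightarrow> 'w \<Rightarrow> real) \<Rightarrow> 'w \<Rightarrow> nat \<Rightarrow> real" where
  "subvector J X \<omega> = (\<lambda>j\<in>J. X j \<omega>)"

definition cdf_on :: "'w measure \<Rightarrow> (nat \<Rightarrow> 'w \<Rightarrow> real) \<Rightarrow> nat set \<Rightarrow> (nat \<Rightarrow> real) \<Rightarrow> real" where
  "cdf_on M X J y = measure M {\<omega> \<in> space M. \<forall>j\<in>J. X j \<omega> \<le> y j}"

text \<open>
  Since \<open>\<rho>\<close> vanishes off \<open>S\<close>, the set \<open>S\<close> is exactly the set where \<open>\<rho>\<close> is positive:
  it is the open support of the law of the subvector on \<open>J\<close>.
\<close>

definition continuous_cdf_with_positive_density ::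
  "'w measure \<Rightarrow> (nat \<Rightarrow> 'w \<Rightarrow> real) \<Rightarrow> nat set \<Rightarrow> ((nat \<Rightarrow> real) \<Rightarrow> real) \<Rightarrow> (nat \<Rightarrow> real) set \<Rightarrow> bool"
where
  "continuous_cdf_with_positive_density M X J \<rho> S \<longleftrightarrow>
     continuous_map (product_topology (\<lambda>_. euclideanreal) J) euclideanreal (cdf_on M X J) \<and>
     distributed M (PiM J (\<lambda>_. lborel)) (subvector J X) (\<lambda>y. ennreal (\<rho> y)) \<and>
     openin (product_topology (\<lambda>_. euclideanreal) J) S \<and>
     (\<forall>y\<in>S. \<rho> y > 0) \<and>
     (\<forall>y\<in>PiE J (\<lambda>_. UNIV) - S. \<rho> y = 0)"

definition block_structure ::
  "'w measure \<Rightarrow> (nat \<Rightarrow> 'w \<Rightarrow> real) \<Rightarrow> nat \<Rightarrow> nat \<Rightarrow> (nat \<Rightarrow> nat set) \<Rightarrow> bool"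
where
  "block_structure M X d K \<pi> \<longleftrightarrow>
     (\<forall>j\<in>{1..d}. X j \<in> borel_measurable M) \<and>
     K \<ge> 1 \<and>
     (\<Union>k\<in>{1..K}. \<pi> k) = {1..d} \<and>
     disjoint_family_on \<pi> {1..K} \<and>
     prob_space.indep_vars M (\<lambda>k. PiM (\<pi> k) (\<lambda>_. borel)) (\<lambda>k. subvector (\<pi> k) X) {1..K} \<and>
     prob_space.indep_vars M (\<lambda>_. borel) X (\<pi> 1) \<and>
     (\<forall>k\<in>{2..K}. card (\<pi> k) \<ge> 2 \<and> \<not> prob_space.indep_vars M (\<lambda>_. borel) X (\<pi> k))"

text \<open>
  The dependency model of the block \<open>B\<close> with explanatory variable \<open>X q\<close>. The components of
  \<open>rq t z\<close> and of \<open>Zq\<close> are indexed by \<open>B - {q}\<close>; \<open>rq t z p\<close> is the component giving \<open>X p\<close>.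
  The domain \<open>D\<close> is the set in which \<open>Zq\<close> takes its values, and \<open>V\<close> is the set of values of
  the block \<open>B\<close>. The last clause says that \<open>z \<mapsto> rq t z\<close> is invertible and that its
  inverse is defined at every value of the remaining variables compatible with \<open>X q = t\<close>.
  The single variable \<open>X q\<close> occurs as the one-coordinate subvector on \<open>{q}\<close> because
  \<open>indep_var\<close> needs both variables to have the same type.
\<close>

definition dependency_model ::
  "'w measure \<Rightarrow> (nat \<Rightarrow> 'w \<Rightarrow> real) \<Rightarrow> nat set \<Rightarrow> (nat \<Rightarrow> real) set \<Rightarrow> nat \<Rightarrow>
   (real \<Rightarrow> (nat \<Rightarrow> real) \<Rightarrow> nat \<Rightarrow> real) \<Rightarrow> (nat \<Rightarrow> 'w \<Rightarrow> real) \<Rightarrow> (nat \<Rightarrow> real) set \<Rightarrow> bool"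
where
  "dependency_model M X B V q rq Zq D \<longleftrightarrow>
     prob_space.indep_vars M (\<lambda>_. borel) Zq (B - {q}) \<and>
     prob_space.indep_var M (PiM {q} (\<lambda>_. borel)) (subvector {q} X)
       (PiM (B - {q}) (\<lambda>_. borel)) (subvector (B - {q}) Zq) \<and>
     D \<subseteq> PiE (B - {q}) (\<lambda>_. UNIV) \<and>
     (AE \<omega> in M. subvector (B - {q}) Zq \<omega> \<in> D) \<and>
     (AE \<omega> in M. subvector (B - {q}) X \<omega> = rq (X q \<omega>) (subvector (B - {q}) Zq \<omega>)) \<and>
     (\<forall>v\<in>V. rq (v q) ` D \<subseteq> PiE (B - {q}) (\<lambda>_. UNIV) \<and>
             inj_on (rq (v q)) D \<and>
             restrict v (B - {q}) \<in> rq (v q) ` D)"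

definition model_inverse ::
  "nat set \<Rightarrow> nat \<Rightarrow> (real \<Rightarrow> (nat \<Rightarrow> real) \<Rightarrow> nat \<Rightarrow> real) \<Rightarrow> (nat \<Rightarrow> real) set \<Rightarrow>
   (nat \<Rightarrow> real) \<Rightarrow> nat \<Rightarrow> real"
where
  "model_inverse B q rq D v = inv_into D (rq (v q)) (restrict v (B - {q}))"

text \<open>
  The variable \<open>X p\<close> of the block as a function of the value \<open>t\<close> of \<open>X q\<close>, the latent vector
  being held at the value \<open>z\<close>.
\<close>

definition model_variable ::
  "nat \<Rightarrow> (real \<Rightarrow> (nat \<Rightarrow> real) \<Rightarrow> nat \<Rightarrow> real) \<Rightarrow> (nat \<Rightarrow> real) \<Rightarrow> nat \<Rightarrow> real \<Rightarrow> real"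
where
  "model_variable q rq z p t = (if p = q then t else rq t z p)"

definition block_of :: "nat \<Rightarrow> (nat \<Rightarrow> nat set) \<Rightarrow> nat \<Rightarrow> nat" where
  "block_of K \<pi> q = (THE k. k \<in> {1..K} \<and> q \<in> \<pi> k)"

definition dep_deriv ::
  "nat \<Rightarrow> (nat \<Rightarrow> nat set) \<Rightarrow> (nat \<Rightarrow> real \<Rightarrow> (nat \<Rightarrow> real) \<Rightarrow> nat \<Rightarrow> real) \<Rightarrow>
   (nat \<Rightarrow> (nat \<Rightarrow> real) set) \<Rightarrow> (nat \<Rightarrow> real) \<Rightarrow> nat \<Rightarrow> nat \<Rightarrow> real"
where
  "dep_deriv K \<pi> r D x p q =
     (if block_of K \<pi> p \<noteq> block_of K \<pi> q then 0
      else if block_of K \<pi> q = 1 then (if p = q then 1 else 0)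
      else deriv (model_variable q (r q) (model_inverse (\<pi> (block_of K \<pi> q)) q (r q) (D q) x) p)
             (x q))"

definition dep_jacobian ::
  "nat \<Rightarrow> (nat \<Rightarrow> nat set) \<Rightarrow> (nat \<Rightarrow> real \<Rightarrow> (nat \<Rightarrow> real) \<Rightarrow> nat \<Rightarrow> real) \<Rightarrow>
   (nat \<Rightarrow> (nat \<Rightarrow> real) set) \<Rightarrow> nat list \<Rightarrow> (nat \<Rightarrow> real) \<Rightarrow> real Matrix.mat"
where
  "dep_jacobian K \<pi> r D cs x =
     Matrix.mat (length cs) (length cs) (\<lambda>(a, b). dep_deriv K \<pi> r D x (cs ! a) (cs ! b))"

definition block_coords :: "(nat \<Rightarrow> nat set) \<Rightarrow> nat \<Rightarrow> nat list" where
  "block_coords \<pi> k = sorted_list_of_set (\<pi> k)"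

definition all_coords :: "nat \<Rightarrow> (nat \<Rightarrow> nat set) \<Rightarrow> nat list" where
  "all_coords K \<pi> = concat (map (block_coords \<pi>) [1..<Suc K])"

definition J_col ::
  "(nat \<Rightarrow> nat set) \<Rightarrow> (nat \<Rightarrow> real \<Rightarrow> (nat \<Rightarrow> real) \<Rightarrow> nat \<Rightarrow> real) \<Rightarrow>
   (nat \<Rightarrow> (nat \<Rightarrow> real) set) \<Rightarrow> nat \<Rightarrow> (nat \<Rightarrow> real) \<Rightarrow> nat \<Rightarrow> real Matrix.vec"
where
  "J_col \<pi> r D k v q =
     Matrix.vec (card (\<pi> k))
       (\<lambda>l. let p = block_coords \<pi> k ! l in
            if p = q then 1
            else deriv (\<lambda>t. r q t (model_inverse (\<pi> k) q (r q) (D q) v) p) (v q))"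

definition J_block ::
  "(nat \<Rightarrow> nat set) \<Rightarrow> (nat \<Rightarrow> real \<Rightarrow> (nat \<Rightarrow> real) \<Rightarrow> nat \<Rightarrow> real) \<Rightarrow>
   (nat \<Rightarrow> (nat \<Rightarrow> real) set) \<Rightarrow> nat \<Rightarrow> (nat \<Rightarrow> real) \<Rightarrow> real Matrix.mat"
where
  "J_block \<pi> r D k v = mat_of_cols (card (\<pi> k)) (map (J_col \<pi> r D k v) (block_coords \<pi> k))"

definition J_full ::
  "nat \<Rightarrow> (nat \<Rightarrow> nat set) \<Rightarrow> (nat \<Rightarrow> real \<Rightarrow> (nat \<Rightarrow> real) \<Rightarrow> nat \<Rightarrow> real) \<Rightarrow>
   (nat \<Rightarrow> (nat \<Rightarrow> real) set) \<Rightarrow> (nat \<Rightarrow> real) \<Rightarrow> real Matrix.mat"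
where
  "J_full K \<pi> r D x =
     diag_block_mat
       (1\<^sub>m (card (\<pi> 1)) # map (\<lambda>k. J_block \<pi> r D k (restrict x (\<pi> k))) [2..<Suc K])"

definition partial_deriv :: "((nat \<Rightarrow> real) \<Rightarrow> real) \<Rightarrow> nat \<Rightarrow> (nat \<Rightarrow> real) \<Rightarrow> real" where
  "partial_deriv f p x = deriv (\<lambda>t. f (x(p := t))) (x p)"

definition formal_gradient ::
  "nat \<Rightarrow> (nat \<Rightarrow> nat set) \<Rightarrow> ((nat \<Rightarrow> real) \<Rightarrow> real) \<Rightarrow> (nat \<Rightarrow> real) \<Rightarrow> real Matrix.vec"
where
  "formal_gradient K \<pi> f x = vec_of_list (map (\<lambda>p. partial_deriv f p x) (all_coords K \<pi>))"

definition dep_partial_deriv ::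
  "nat \<Rightarrow> nat \<Rightarrow> (nat \<Rightarrow> nat set) \<Rightarrow> (nat \<Rightarrow> real \<Rightarrow> (nat \<Rightarrow> real) \<Rightarrow> nat \<Rightarrow> real) \<Rightarrow>
   (nat \<Rightarrow> (nat \<Rightarrow> real) set) \<Rightarrow> ((nat \<Rightarrow> real) \<Rightarrow> real) \<Rightarrow> (nat \<Rightarrow> real) \<Rightarrow> nat \<Rightarrow> real"
where
  "dep_partial_deriv d K \<pi> r D f x q =
     (\<Sum>p = 1..d. partial_deriv f p x * dep_deriv K \<pi> r D x p q)"

definition dep_gradient ::
  "nat \<Rightarrow> nat \<Rightarrow> (nat \<Rightarrow> nat set) \<Rightarrow> (nat \<Rightarrow> real \<Rightarrow> (nat \<Rightarrow> real) \<Rightarrow> nat \<Rightarrow> real) \<Rightarrow>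
   (nat \<Rightarrow> (nat \<Rightarrow> real) set) \<Rightarrow> ((nat \<Rightarrow> real) \<Rightarrow> real) \<Rightarrow> (nat \<Rightarrow> real) \<Rightarrow> real Matrix.vec"
where
  "dep_gradient d K \<pi> r D f x =
     vec_of_list (map (dep_partial_deriv d K \<pi> r D f x) (all_coords K \<pi>))"

end

theory Submission
  imports Defs
begin

text \<open>At a fixed point, an entry of the Jacobian depends only on its pair of coordinates,
  through \<open>dep_deriv\<close>. Derivatives across blocks vanish, so listing the coordinates
  block by block makes the matrix block-diagonal; this is the purely combinatorial
  \<open>mat_concat_eq_diag_block_mat\<close>. The diagonal blocks are found entry by entry: block 1
  gives the identity (\<open>dep_jacobian_first_block\<close>), a dependent block gives the columns
  \<open>J_col\<close> (\<open>dep_jacobian_block\<close>), and \<open>dep_jacobian_all\<close>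
  assembles them.

  The gradient formula is the chain-rule sum read as a matrix-vector product, with the sum over
  \<open>{1..d}\<close> moved to list positions (\<open>dep_gradient_eq\<close>).

  Since \<open>deriv\<close> is a total function, these equalities do not by themselves say that the
  derivatives exist. Existence is shown separately: a sample in \<open>S\<close> has its latent
  vector in \<open>D q\<close> (\<open>model_inverse_in_domain\<close>), where the model is assumed
  differentiable.\<close>

lemma mat_concat_eq_diag_block_mat:
  fixes g :: "'a \<Rightarrow> 'a \<Rightarrow> 'b :: zero"
  assumes "sorted_wrt (\<lambda>B C. \<forall>p\<in>set B. \<forall>q\<in>set C. g p q = 0 \<and> g q p = 0) Bs"
  shows "Matrix.mat (length (concat Bs)) (length (concat Bs))
           (\<lambda>(a, b). g (concat Bs ! a) (concat Bs ! b)) =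
         diag_block_mat
           (map (\<lambda>B. Matrix.mat (length B) (length B) (\<lambda>(a, b). g (B ! a) (B ! b))) Bs)"
  using assms
proof (induction Bs)
  case Nil
  show ?case by (intro eq_matI) auto
next
  case (Cons B Bs)
  let ?G = "\<lambda>C. Matrix.mat (length C) (length C) (\<lambda>(a, b). g (C ! a) (C ! b))"
  have z: "g p q = 0" "g q p = 0" if "p \<in> set B" "q \<in> set (concat Bs)" for p q
    using Cons.prems that by auto
  have IH: "diag_block_mat (map ?G Bs) = ?G (concat Bs)"
    using Cons by simp
  \<comment> \<open>This is one unfolding of \<open>diag_block_mat\<close>, whose recursion puts
    zero matrices beside and below the head block.\<close>
  have "?G (B @ concat Bs) =
        four_block_mat (?G B) (0\<^sub>m (length B) (length (concat Bs)))
          (0\<^sub>m (length (concat Bs)) (length B)) (?G (concat Bs))"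
  proof (rule eq_matI, goal_cases)
    case (1 a b)
    then have "a < length B + length (concat Bs)" "b < length B + length (concat Bs)"
      by simp_all
    \<comment> \<open>The two instances of \<open>z\<close> clear the upper right corner
      (\<open>a\<close> in the head, \<open>b\<close> beyond it) and the lower left one; positions
      beyond the head are shifted by \<open>length B\<close>.\<close>
    then show ?case
      using z[of "B ! a" "concat Bs ! (b - length B)"] z[of "B ! b" "concat Bs ! (a - length B)"]
      by (simp add: nth_append del: set_concat)
  qed simp_all
  then show ?case
    by (simp add: IH Let_def)
qed

lemma sum_set_eq_sum_nth:
  assumes "distinct xs"
  shows "sum h (set xs) = (\<Sum>i = 0..<length xs. h (xs ! i))"
  using assms by (simp add: sum_list_distinct_conv_sum_set[symmetric] sum_list_sum_nth)

lemma block_of_eq: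
  assumes "disjoint_family_on \<pi> {1..K}" "k \<in> {1..K}" "q \<in> \<pi> k"
  shows "block_of K \<pi> q = k"
  unfolding block_of_def
proof (rule the_equality)
  show "k \<in> {1..K} \<and> q \<in> \<pi> k" using assms by blast
  show "j = k" if "j \<in> {1..K} \<and> q \<in> \<pi> j" for j
    using assms that unfolding disjoint_family_on_def by blast
qed

text \<open>The inverse reads \<open>v\<close> only at \<open>q\<close> and on
  \<open>B - {q}\<close>, all inside \<open>B\<close>. Hence \<open>J_block\<close>, which sees only
  the subvector of the block, uses the same latent vector as \<open>dep_deriv\<close> at the full
  point.\<close>

lemma model_inverse_restrict:
  "q \<in> B \<Longrightarrow> model_inverse B q rq D (restrict v B) = model_inverse B q rq D v"
  by (simp add: model_inverse_def Int_absorb1)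

text \<open>The last clause of the model provides a preimage in \<open>D\<close>, so
  \<open>inv_into\<close> returns a genuine latent value and not an arbitrary default.\<close>

lemma model_inverse_in_domain:
  assumes "dependency_model M X B V q rq Zq D" "v \<in> V"
  shows "model_inverse B q rq D v \<in> D"
proof -
  have "restrict v (B - {q}) \<in> rq (v q) ` D"
    using assms by (simp add: dependency_model_def)
  then show ?thesis
    unfolding model_inverse_def by (rule inv_into_into)
qed

lemma J_block_carrier:
  "J_block \<pi> r D k v \<in> carrier_mat (card (\<pi> k)) (card (\<pi> k))"
  by (rule carrier_matI) (simp_all add: J_block_def block_coords_def)

lemma dep_jacobian_block:
  assumes disj: "disjoint_family_on \<pi> {1..K}" and k: "k \<in> {2..K}" and fin: "finite (\<pi> k)"
  shows "dep_jacobian K \<pi> r D (block_coords \<pi> k) x = J_block \<pi> r D k (restrict x (\<pi> k))"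
proof (rule eq_matI)
  let ?cs = "block_coords \<pi> k"
  have len: "length ?cs = card (\<pi> k)" by (simp add: block_coords_def)
  have "dim_row (J_block \<pi> r D k (restrict x (\<pi> k))) = card (\<pi> k)"
    and "dim_col (J_block \<pi> r D k (restrict x (\<pi> k))) = card (\<pi> k)"
    using J_block_carrier[of \<pi> r D k "restrict x (\<pi> k)"] by auto
  note dims = this
  then show "dim_row (dep_jacobian K \<pi> r D ?cs x) = dim_row (J_block \<pi> r D k (restrict x (\<pi> k)))"
    and "dim_col (dep_jacobian K \<pi> r D ?cs x) = dim_col (J_block \<pi> r D k (restrict x (\<pi> k)))"
    by (simp_all add: dep_jacobian_def len)
  fix a b
  assume "a < dim_row (J_block \<pi> r D k (restrict x (\<pi> k)))"
    and "b < dim_col (J_block \<pi> r D k (restrict x (\<pi> k)))"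
  then have ab: "a < card (\<pi> k)" "b < card (\<pi> k)" by (simp_all add: dims)
  then have "?cs ! a \<in> set ?cs" "?cs ! b \<in> set ?cs" by (simp_all add: len)
  then have mem: "?cs ! a \<in> \<pi> k" "?cs ! b \<in> \<pi> k"
    using fin by (simp_all add: block_coords_def)
  have blk: "block_of K \<pi> (?cs ! a) = k" "block_of K \<pi> (?cs ! b) = k"
    using disj k mem by (auto intro!: block_of_eq)
  \<comment> \<open>On the diagonal \<open>model_variable\<close> is the identity in
    \<open>t\<close>, with derivative 1 as in \<open>J_col\<close>; off it, both sides differentiate
    the same component of the model at the same latent vector.\<close>
  show "dep_jacobian K \<pi> r D ?cs x $$ (a, b) = J_block \<pi> r D k (restrict x (\<pi> k)) $$ (a, b)"
    using ab k mem
    by (cases "?cs ! a = ?cs ! b")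
      (simp_all add: dep_jacobian_def J_block_def mat_of_cols_index J_col_def len blk dep_deriv_def
        model_variable_def[abs_def] model_inverse_restrict)
qed

lemma dep_jacobian_first_block:
  assumes disj: "disjoint_family_on \<pi> {1..K}" and K: "1 \<le> K" and fin: "finite (\<pi> 1)"
  shows "dep_jacobian K \<pi> r D (block_coords \<pi> 1) x = 1\<^sub>m (card (\<pi> 1))"
proof (rule eq_matI)
  let ?cs = "block_coords \<pi> 1"
  have len: "length ?cs = card (\<pi> 1)" and dist: "distinct ?cs"
    by (simp_all add: block_coords_def)
  then show "dim_row (dep_jacobian K \<pi> r D ?cs x) = dim_row (1\<^sub>m (card (\<pi> 1)))"
    and "dim_col (dep_jacobian K \<pi> r D ?cs x) = dim_col (1\<^sub>m (card (\<pi> 1)))"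
    by (simp_all add: dep_jacobian_def)
  have blk: "block_of K \<pi> (?cs ! a) = 1" if "a < card (\<pi> 1)" for a
  proof (rule block_of_eq[OF disj])
    show "?cs ! a \<in> \<pi> 1"
      using nth_mem[of a ?cs] that fin by (simp add: block_coords_def del: nth_mem)
  qed (use K in auto)
  fix a b
  assume "a < dim_row (1\<^sub>m (card (\<pi> 1)))" and "b < dim_col (1\<^sub>m (card (\<pi> 1)))"
  \<comment> \<open>Within block 1 the derivative is a Kronecker delta on coordinates; distinctness
    of the list turns it into one on positions.\<close>
  then show "dep_jacobian K \<pi> r D ?cs x $$ (a, b) = 1\<^sub>m (card (\<pi> 1)) $$ (a, b)"
    using dist by (simp add: dep_jacobian_def len blk dep_deriv_def nth_eq_iff_index_eq
        del: One_nat_def)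
qed

lemma dep_jacobian_all:
  assumes disj: "disjoint_family_on \<pi> {1..K}" and K: "1 \<le> K"
    and fin: "\<And>k. k \<in> {1..K} \<Longrightarrow> finite (\<pi> k)"
  shows "dep_jacobian K \<pi> r D (all_coords K \<pi>) x = J_full K \<pi> r D x"
proof -
  let ?g = "dep_deriv K \<pi> r D x"
  have "sorted_wrt (\<lambda>i j. \<forall>p\<in>set (block_coords \<pi> i). \<forall>q\<in>set (block_coords \<pi> j).
          ?g p q = 0 \<and> ?g q p = 0) [1..<Suc K]"
  proof (rule sorted_wrt_mono_rel[OF _ sorted_wrt_upt])
    \<comment> \<open>Only pairs \<open>i < j\<close> need checking, because the condition on a pair
      of blocks covers both orders of differentiation.\<close>
    fix i j assume ij: "i \<in> set [1..<Suc K]" "j \<in> set [1..<Suc K]" "i < j"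
    have "block_of K \<pi> p = i" if "p \<in> set (block_coords \<pi> i)" for p
      using that ij disj fin by (intro block_of_eq) (auto simp: block_coords_def)
    moreover have "block_of K \<pi> q = j" if "q \<in> set (block_coords \<pi> j)" for q
      using that ij disj fin by (intro block_of_eq) (auto simp: block_coords_def)
    ultimately show "\<forall>p\<in>set (block_coords \<pi> i). \<forall>q\<in>set (block_coords \<pi> j).
        ?g p q = 0 \<and> ?g q p = 0"
      using \<open>i < j\<close> by (auto simp: dep_deriv_def)
  qed
  then have "dep_jacobian K \<pi> r D (all_coords K \<pi>) x =
      diag_block_mat (map (\<lambda>k. dep_jacobian K \<pi> r D (block_coords \<pi> k) x) [1..<Suc K])"
    unfolding dep_jacobian_def all_coords_def
    by (subst mat_concat_eq_diag_block_mat) (simp_all add: sorted_wrt_map comp_def del: upt_Suc)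
  also have "[1..<Suc K] = 1 # [2..<Suc K]"
    using K by (simp add: upt_conv_Cons numeral_2_eq_2 del: upt_Suc)
  also have "map (\<lambda>k. dep_jacobian K \<pi> r D (block_coords \<pi> k) x) (1 # [2..<Suc K]) =
      1\<^sub>m (card (\<pi> 1)) # map (\<lambda>k. J_block \<pi> r D k (restrict x (\<pi> k))) [2..<Suc K]"
    using dep_jacobian_first_block[OF disj K] dep_jacobian_block[OF disj] K fin
    by (auto simp del: upt_Suc)
  finally show ?thesis by (simp add: J_full_def)
qed

lemma set_all_coords:
  assumes "\<And>k. k \<in> {1..K} \<Longrightarrow> finite (\<pi> k)"
  shows "set (all_coords K \<pi>) = (\<Union>k\<in>{1..K}. \<pi> k)"
  using assms
  by (simp add: all_coords_def block_coords_def atLeastLessThanSuc_atLeastAtMost del: upt_Suc)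

lemma distinct_all_coords:
  assumes disj: "disjoint_family_on \<pi> {1..K}" and fin: "\<And>k. k \<in> {1..K} \<Longrightarrow> finite (\<pi> k)"
  shows "distinct (all_coords K \<pi>)"
proof -
  have set_bc: "set (block_coords \<pi> k) = \<pi> k" if "k \<in> {1..K}" for k
    using fin that by (simp add: block_coords_def)
  \<comment> \<open>The range of block indices is generalised to any distinct list of them, so that
    the induction can drop the head.\<close>
  have "distinct (concat (map (block_coords \<pi>) ks))" if "distinct ks" "set ks \<subseteq> {1..K}" for ks
    using that
  proof (induction ks)
    case (Cons k ks)
    have "\<pi> k \<inter> \<pi> j = {}" if "j \<in> set ks" for j
    proof (rule disjoint_family_onD[OF disj])
      show "k \<noteq> j" using Cons.prems(1) that by auto
    qed (use Cons.prems that in auto)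
    moreover have "set (block_coords \<pi> j) = \<pi> j" if "j \<in> set (k # ks)" for j
      using Cons.prems that by (intro set_bc) auto
    ultimately have "set (block_coords \<pi> k) \<inter> set (concat (map (block_coords \<pi>) ks)) = {}"
      by auto
    moreover have "distinct (block_coords \<pi> k)"
      by (simp add: block_coords_def)
    moreover have "distinct (concat (map (block_coords \<pi>) ks))"
      using Cons.prems by (intro Cons.IH) auto
    ultimately show ?case
      by (simp only: list.map concat.simps distinct_append simp_thms)
  qed simp
  then show ?thesis
    unfolding all_coords_def by (simp del: upt_Suc add: atLeastLessThanSuc_atLeastAtMost)
qed

text \<open>The defining sum runs over the row index of the Jacobian, hence the transpose. A
  repetition-free listing of \<open>{1..d}\<close> lets that sum be taken over positions
  instead.\<close>

lemma dep_gradient_eq: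
  assumes dist: "distinct (all_coords K \<pi>)" and set: "set (all_coords K \<pi>) = {1..d}"
  shows "dep_gradient d K \<pi> r D f x =
    transpose_mat (dep_jacobian K \<pi> r D (all_coords K \<pi>) x) *\<^sub>v formal_gradient K \<pi> f x"
proof (rule eq_vecI)
  let ?cs = "all_coords K \<pi>"
  let ?R = "transpose_mat (dep_jacobian K \<pi> r D ?cs x) *\<^sub>v formal_gradient K \<pi> f x"
  show "dim_vec (dep_gradient d K \<pi> r D f x) = dim_vec ?R"
    by (simp add: dep_gradient_def dep_jacobian_def)
  fix b assume "b < dim_vec ?R"
  then have b: "b < length ?cs" by (simp add: dep_jacobian_def)
  have "vec_index (dep_gradient d K \<pi> r D f x) b = dep_partial_deriv d K \<pi> r D f x (?cs ! b)"
    using b by (simp add: dep_gradient_def vec_of_list_index)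
  also have "\<dots> = (\<Sum>p\<in>set ?cs. partial_deriv f p x * dep_deriv K \<pi> r D x p (?cs ! b))"
    by (simp add: dep_partial_deriv_def set)
  also have "\<dots> = (\<Sum>a = 0..<length ?cs.
      partial_deriv f (?cs ! a) x * dep_deriv K \<pi> r D x (?cs ! a) (?cs ! b))"
    by (rule sum_set_eq_sum_nth[OF dist])
  also have "\<dots> = vec_index ?R b"
    using b by (auto simp: dep_jacobian_def formal_gradient_def scalar_prod_def vec_of_list_index
        mult.commute intro!: sum.cong)
  finally show "vec_index (dep_gradient d K \<pi> r D f x) b = vec_index ?R b" .
qed

theorem theorem3:
  fixes M :: "'w measure"
    and X :: "nat \<Rightarrow> 'w \<Rightarrow> real"
    and d K :: nat
    and \<pi> :: "nat \<Rightarrow> nat set"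
    and \<rho> :: "(nat \<Rightarrow> real) \<Rightarrow> real"
    and S :: "(nat \<Rightarrow> real) set"
    and r :: "nat \<Rightarrow> real \<Rightarrow> (nat \<Rightarrow> real) \<Rightarrow> nat \<Rightarrow> real"
    and Z :: "nat \<Rightarrow> nat \<Rightarrow> 'w \<Rightarrow> real"
    and D :: "nat \<Rightarrow> (nat \<Rightarrow> real) set"
    and f :: "(nat \<Rightarrow> real) \<Rightarrow> real"
    and x :: "nat \<Rightarrow> real"
  assumes "prob_space M"
    and blocks: "block_structure M X d K \<pi>"
    and models: "\<And>k q. k \<in> {2..K} \<Longrightarrow> q \<in> \<pi> k \<Longrightarrow>
      dependency_model M X (\<pi> k) ((\<lambda>y. restrict y (\<pi> k)) ` S) q (r q) (Z q) (D q)"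
    and A2_joint: "continuous_cdf_with_positive_density M X {1..d} \<rho> S"
    and A2_marginal: "\<And>j. j \<in> {1..d} \<Longrightarrow>
      \<exists>\<rho>' S'. continuous_cdf_with_positive_density M X {j} \<rho>' S'"
    and A3: "\<And>k q p z t. k \<in> {2..K} \<Longrightarrow> q \<in> \<pi> k \<Longrightarrow> p \<in> \<pi> k - {q} \<Longrightarrow> z \<in> D q \<Longrightarrow>
      t \<in> (\<lambda>y. y q) ` S \<Longrightarrow> (\<lambda>s. r q s z p) differentiable (at t)"
    and A4: "\<And>y p. y \<in> PiE {1..d} (\<lambda>_. UNIV) \<Longrightarrow> p \<in> {1..d} \<Longrightarrow>
      (\<lambda>t. f (y(p := t))) differentiable (at (y p))"
    and sample: "x \<in> S"
  shows "(\<forall>k\<in>{2..K}.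
           (\<forall>p\<in>\<pi> k. \<forall>q\<in>\<pi> k.
              model_variable q (r q) (model_inverse (\<pi> k) q (r q) (D q) x) p
                differentiable (at (x q))) \<and>
           dep_jacobian K \<pi> r D (block_coords \<pi> k) x = J_block \<pi> r D k (restrict x (\<pi> k)) \<and>
           J_block \<pi> r D k (restrict x (\<pi> k)) \<in> carrier_mat (card (\<pi> k)) (card (\<pi> k))) \<and>
         dep_jacobian K \<pi> r D (all_coords K \<pi>) x = J_full K \<pi> r D x \<and>
         dep_gradient d K \<pi> r D f x =
           transpose_mat (J_full K \<pi> r D x) *\<^sub>v formal_gradient K \<pi> f x"
proof -
  from blocks have K: "1 \<le> K" and union: "(\<Union>k\<in>{1..K}. \<pi> k) = {1..d}"
    and disj: "disjoint_family_on \<pi> {1..K}"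
    by (simp_all add: block_structure_def)
  have fin: "finite (\<pi> k)" if "k \<in> {1..K}" for k
    using union that by (metis UN_upper finite_atLeastAtMost finite_subset)
  have "model_variable q (r q) (model_inverse (\<pi> k) q (r q) (D q) x) p differentiable (at (x q))"
    if k: "k \<in> {2..K}" and p: "p \<in> \<pi> k" and q: "q \<in> \<pi> k" for k p q
  proof (cases "p = q")
    \<comment> \<open>The explanatory variable itself is the identity in \<open>t\<close>; A3 speaks
      of the other components.\<close>
    case True
    then show ?thesis by (simp add: model_variable_def[abs_def])
  next
    case False
    \<comment> \<open>As \<open>x\<close> lies in \<open>S\<close>, its subvector on the block is
      one of the values at which the model is invertible.\<close>
    have "model_inverse (\<pi> k) q (r q) (D q) (restrict x (\<pi> k)) \<in> D q"
      using sample by (intro model_inverse_in_domain[OF models[OF k q]]) blast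
    then have "model_inverse (\<pi> k) q (r q) (D q) x \<in> D q"
      by (simp add: model_inverse_restrict q)
    \<comment> \<open>A3 is applied at the latent vector of \<open>x\<close> and at
      \<open>t = x q\<close>, a value of that coordinate on \<open>S\<close>.\<close>
    then show ?thesis
      using A3[OF k q, of p] p False sample by (simp add: model_variable_def[abs_def])
  qed
  moreover have "dep_jacobian K \<pi> r D (block_coords \<pi> k) x = J_block \<pi> r D k (restrict x (\<pi> k))"
    if "k \<in> {2..K}" for k
    using that by (intro dep_jacobian_block disj fin) auto
  moreover have "dep_jacobian K \<pi> r D (all_coords K \<pi>) x = J_full K \<pi> r D x"
    by (rule dep_jacobian_all[OF disj K fin])
  moreover have "dep_gradient d K \<pi> r D f x =
      transpose_mat (dep_jacobian K \<pi> r D (all_coords K \<pi>) x) *\<^sub>v formal_gradient K \<pi> f x"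
    by (intro dep_gradient_eq distinct_all_coords[OF disj fin])
      (simp_all only: set_all_coords[OF fin] union)
  ultimately show ?thesis
    using J_block_carrier by simp
qed

end
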